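(* Let $G$ be a distance-regularized graph, let $v$ be a vertex of $G$ with intersection array \[ \iota(v)=\left[\begin{array}{ccccc} \ast & c_1(v) & \cdots & c_{d-1}(v) & c_d(v)\\ 0 & a_1(v) & \cdots & a_{d-1}(v) & a_d(v)\\ b_0(v) & b_1(v) & \cdots & b_{d-1}(v) & \ast \end{array}\right], \] and let $B(v)$ be the tridiagonal matrix with rows and columns indexed by $\Gamma_0,\ldots,\Gamma_d$ given by \[ B(v)_{\Gamma_{j-1},\Gamma_j}=c_j(v)\ (1\le j\le d),\quad B(v)_{\Gamma_j,\Gamma_j}=a_j(v)\ (0\le j\le d,\ a_0(v)=0),\quad B(v)_{\Gamma_{j+1},\Gamma_j}=b_j(v)\ (0\le j\le d-1), \] all other entries being $0$. Then, for every $i\in\{1,\ldots,d\}$ and every vertex $u$ at distance $i$ from $v$, \[ H(G;(v,u))=H_m(G;(v,u))=\mathbf{H}\bigl(T(B(v))_{-\Gamma_0}\bigr)_{\Gamma_i}. \]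
   Context: The graph $G$ is finite, connected and undirected, with vertex set $V$ and adjacency matrix $A$. For a nonnegative square matrix $M=(m_{ij})$, $T(M)$ is the matrix with $(i,j)$-entry $m_{ij}/\sum_l m_{lj}$, read as the transition probability from $j$ to $i$. $M_{-x}$ is $M$ with the row and column indexed by $x$ removed (remaining indices keep their names), and $\mathbf{H}(M)=-\mathbf{1}(M-I)^{-1}$, where $\mathbf{1}$ is the all-one row vector; $\mathbf{H}(M)_x$ is its entry indexed by $x$. The simple random walk on $G$ has transition matrix $T(A)$. With $\nu$ the positive unit eigenvector of $A$ for its largest eigenvalue (Perron eigenvector), the maximal entropy random walk has transition matrix $T(\mathrm{diag}(\nu)A)$, i.e. it moves from $u$ to a neighbour $w$ with probability $\nu_w/\sum_{x\sim u}\nu_x$. $H(G;(v,u))$ and $H_m(G;(v,u))$ are the expected numbers of steps needed by the simple, respectively maximal entropy, random walk started at $u$ to reach $v$ for the first time. $\Gamma_i(u)$ is the set of vertices at distance $i$ from $u$. For $w\in\Gamma_i(u)$ let $c(u,w)=|\Gamma_{i-1}(u)\cap\Gamma_1(w)|$ (for $i\ge1$), $a(u,w)=|\Gamma_i(u)\cap\Gamma_1(w)|$, $b(u,w)=|\Gamma_{i+1}(u)\cap\Gamma_1(w)|$. The vertex $u$ is distance-regularized if for every $i$ these numbers do not depend on the choice of $w\in\Gamma_i(u)$; they are then denoted $c_i(u),a_i(u),b_i(u)$, and form the intersection array $\iota(u)$. A distance-regularized graph is a connected graph in which every vertex is distance-regularized. For the given vertex $v$, $d$ denotes the largest distance of a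 vertex from $v$. *)

theory Defs
  imports
    "HOL-Probability.Probability"
    "Graph_Theory.Pair_Digraph"
    "Graph_Theory.Digraph_Component"
begin

section \<open>Square matrices over a finite index set\<close>

text \<open>
  Matrices carry their index set, so that deleting a row and a column keeps the names of the
  remaining indices. Entries outside the index set are irrelevant.
\<close>

record 'i sqmat =
  idx :: "'i set"
  ent :: "'i \<Rightarrow> 'i \<Rightarrow> real"

text \<open>Column-stochastic normalisation: the entry at \<open>(i, j)\<close> is a transition probability
  from \<open>j\<close> to \<open>i\<close>.\<close>

definition T_mat :: "'i sqmat \<Rightarrow> 'i sqmat" where
  "T_mat M = \<lparr> idx = idx M, ent = (\<lambda>i j. ent M i j / (\<Sum>l\<in>idx M. ent M l j)) \<rparr>"

definition del_mat :: "'i sqmat \<Rightarrow> 'i \<Rightarrow> 'i sqmat" where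
  "del_mat M x = \<lparr> idx = idx M - {x}, ent = ent M \<rparr>"

definition id_mat :: "'i set \<Rightarrow> 'i sqmat" where
  "id_mat I = \<lparr> idx = I, ent = (\<lambda>i j. if i = j then 1 else 0) \<rparr>"

definition minus_mat :: "'i sqmat \<Rightarrow> 'i sqmat \<Rightarrow> 'i sqmat" where
  "minus_mat M N = \<lparr> idx = idx M, ent = (\<lambda>i j. ent M i j - ent N i j) \<rparr>"

definition times_mat :: "'i sqmat \<Rightarrow> 'i sqmat \<Rightarrow> 'i sqmat" where
  "times_mat M N = \<lparr> idx = idx M, ent = (\<lambda>i j. \<Sum>k\<in>idx M. ent M i k * ent N k j) \<rparr>"

definition diag_mat :: "'i set \<Rightarrow> ('i \<Rightarrow> real) \<Rightarrow> 'i sqmat" where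
  "diag_mat I f = \<lparr> idx = I, ent = (\<lambda>i j. if i = j then f i else 0) \<rparr>"

definition mat_eq :: "'i sqmat \<Rightarrow> 'i sqmat \<Rightarrow> bool" where
  "mat_eq M N \<longleftrightarrow> idx M = idx N \<and> (\<forall>i\<in>idx M. \<forall>j\<in>idx M. ent M i j = ent N i j)"

definition is_inverse_mat :: "'i sqmat \<Rightarrow> 'i sqmat \<Rightarrow> bool" where
  "is_inverse_mat M N \<longleftrightarrow> idx N = idx M \<and>
     mat_eq (times_mat M N) (id_mat (idx M)) \<and> mat_eq (times_mat N M) (id_mat (idx M))"

definition invertible_sqmat :: "'i sqmat \<Rightarrow> bool" where
  "invertible_sqmat M \<longleftrightarrow> (\<exists>N. is_inverse_mat M N)"

text \<open>Unspecified if \<open>M\<close> is not invertible, as for \<^const>\<open>matrix_inv\<close>.\<close>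

definition inverse_mat :: "'i sqmat \<Rightarrow> 'i sqmat" where
  "inverse_mat M = (SOME N. is_inverse_mat M N)"

text \<open>\<open>H_vec M x\<close> is the entry at \<open>x\<close> of the row vector \<open>- 1 (M - I)\<^sup>-\<^sup>1\<close>,
  where \<open>1\<close> is the all-one row vector.\<close>

definition H_vec :: "'i sqmat \<Rightarrow> 'i \<Rightarrow> real" where
  "H_vec M x = - (\<Sum>k\<in>idx M. ent (inverse_mat (minus_mat M (id_mat (idx M)))) k x)"

definition eigenvector_mat :: "'i sqmat \<Rightarrow> ('i \<Rightarrow> real) \<Rightarrow> real \<Rightarrow> bool" where
  "eigenvector_mat M f t \<longleftrightarrow> (\<exists>i\<in>idx M. f i \<noteq> 0) \<and>
     (\<forall>i\<in>idx M. (\<Sum>j\<in>idx M. ent M i j * f j) = t * f i)"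

text \<open>Only real eigenvalues are considered; this is meant for symmetric \<open>M\<close>.\<close>

definition perron_eigenvector :: "'i sqmat \<Rightarrow> ('i \<Rightarrow> real) \<Rightarrow> bool" where
  "perron_eigenvector M \<nu> \<longleftrightarrow>
     (\<exists>t. eigenvector_mat M \<nu> t \<and> (\<forall>s f. eigenvector_mat M f s \<longrightarrow> s \<le> t)) \<and>
     (\<forall>i\<in>idx M. 0 < \<nu> i) \<and> (\<Sum>i\<in>idx M. (\<nu> i)\<^sup>2) = 1"


section \<open>Markov chains and hitting times\<close>

text \<open>
  \<open>step_pmf M x\<close> is the distribution of the next state after \<open>x\<close>, given by the column of the
  column-stochastic matrix \<open>M\<close> at \<open>x\<close>. It is unspecified if that column is not a probability
  vector (in particular for \<open>x\<close> outside the index set); such states are never reached below.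
\<close>

definition step_pmf :: "'a sqmat \<Rightarrow> 'a \<Rightarrow> 'a pmf" where
  "step_pmf M x = embed_pmf (\<lambda>y. if y \<in> idx M then ent M y x else 0)"

lemma pmf_step_pmf:
  assumes "finite (idx M)" "\<forall>y\<in>idx M. 0 \<le> ent M y x" "(\<Sum>y\<in>idx M. ent M y x) = 1"
  shows "pmf (step_pmf M x) y = (if y \<in> idx M then ent M y x else 0)"
  unfolding step_pmf_def
proof (rule pmf_embed_pmf)
  have "(\<integral>\<^sup>+ y. ennreal (if y \<in> idx M then ent M y x else 0) \<partial>count_space UNIV) =
      (\<Sum>y\<in>idx M. ennreal (ent M y x))"
    by (subst nn_integral_count_space'[OF assms(1)]) auto
  also have "\<dots> = 1"
    using assms by (simp add: sum_ennreal)
  finally show "(\<integral>\<^sup>+ y. ennreal (if y \<in> idx M then ent M y x else 0) \<partial>count_space UNIV) = 1" .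
qed (use assms in auto)

text \<open>
  The law of the whole trajectory of the chain started at \<open>u\<close>, on the space of sequences
  \<open>nat \<Rightarrow> 'a\<close>, is the measure given by the Ionescu-Tulcea theorem from the conditional laws of
  the state at time \<open>n\<close> given the states at the times \<open>0, ..., n - 1\<close>.
\<close>

definition chain_step :: "'a sqmat \<Rightarrow> 'a \<Rightarrow> nat \<Rightarrow> (nat \<Rightarrow> 'a) \<Rightarrow> 'a measure" where
  "chain_step M u n \<omega> =
     measure_pmf (case n of 0 \<Rightarrow> return_pmf u | Suc m \<Rightarrow> step_pmf M (\<omega> m))"

lemma Ionescu_Tulcea_chain:
  "Ionescu_Tulcea (chain_step M u) (\<lambda>_. count_space UNIV)"
proof (rule Ionescu_Tulcea.intro)
  show "chain_step M u i \<in> measurable (PiM {0..<i} (\<lambda>_. count_space UNIV))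
          (subprob_algebra (count_space UNIV))" for i
  proof (cases i)
    case 0
    then show ?thesis
      using measure_pmf_in_subprob_algebra[of "return_pmf u"] by (simp add: chain_step_def[abs_def])
  next
    case (Suc m)
    have "(\<lambda>\<omega>. \<omega> m) \<in> measurable (PiM {0..<i} (\<lambda>_. count_space UNIV)) (count_space UNIV)"
      by (rule measurable_component_singleton) (simp add: Suc)
    then have "(\<lambda>\<omega>. measure_pmf (step_pmf M (\<omega> m))) \<in>
        measurable (PiM {0..<i} (\<lambda>_. count_space UNIV)) (subprob_algebra (count_space UNIV))"
      by (rule measurable_compose) (auto simp: measure_pmf_in_subprob_algebra)
    with Suc show ?thesis
      by (simp add: chain_step_def[abs_def])
  qed
  show "prob_space (chain_step M u i x)" for i :: nat and x
    unfolding chain_step_def by (rule prob_space_measure_pmf)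
qed

definition chain_measure :: "'a sqmat \<Rightarrow> 'a \<Rightarrow> (nat \<Rightarrow> 'a) measure" where
  "chain_measure M u =
     projective_family.lim UNIV (Ionescu_Tulcea.CI (chain_step M u) (\<lambda>_. count_space UNIV))
       (\<lambda>_. count_space UNIV)"

text \<open>The law of the initial segment of the trajectory is the usual product of transition
  probabilities.\<close>

lemma chain_cylinder:
  "emeasure (chain_measure M u) {\<omega>. \<forall>k\<le>n. \<omega> k = x k} =
     ennreal (pmf (return_pmf u) (x 0) * (\<Prod>k<n. pmf (step_pmf M (x k)) (x (Suc k))))"
proof -
  let ?S = "\<lambda>_::nat. count_space (UNIV::'a set)"
  interpret IT: Ionescu_Tulcea "chain_step M u" ?S by (rule Ionescu_Tulcea_chain)
  let ?X = "\<lambda>n. PiE {0..<n} (\<lambda>k. {x k})"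
  have X[measurable]: "?X n \<in> sets (PiM {0..<n} ?S)" for n
    by (intro sets_PiM_I_finite) auto
  have C: "emeasure (IT.C 0 n (\<lambda>_. undefined)) (?X n) = (\<Prod>k<n. emeasure (chain_step M u k x) {x k})" for n
  proof (induction n)
    case 0
    show ?case by (simp add: PiM_empty)
  next
    case (Suc n)
    have un: "(\<lambda>_. undefined) \<in> space (PiM {0..<0} ?S)" by (simp add: space_PiM)
    have step: "emeasure (IT.eP n w) (?X (Suc n)) =
        emeasure (chain_step M u n x) {x n} * indicator (?X n) w"
      if w: "w \<in> space (PiM {0..<n} ?S)" for w
    proof -
      have "emeasure (IT.eP n w) (?X (Suc n)) =
        emeasure (chain_step M u n w) ((\<lambda>y. w(n := y)) -` ?X (Suc n) \<inter> UNIV)"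
        using IT.emeasure_eP[OF w X[of "Suc n"]] by simp
      also have "(\<lambda>y. w(n := y)) -` ?X (Suc n) \<inter> UNIV = (if w \<in> ?X n then {x n} else {})"
        using w by (auto simp: PiE_iff space_PiM extensional_def fun_upd_def split: if_splits)
      also have "emeasure (chain_step M u n w) \<dots> = emeasure (chain_step M u n x) {x n} * indicator (?X n) w"
        by (auto simp: chain_step_def PiE_iff split: nat.split)
      finally show ?thesis .
    qed
    have "emeasure (IT.C 0 (Suc n) (\<lambda>_. undefined)) (?X (Suc n)) =
       (\<integral>\<^sup>+w. emeasure (IT.eP n w) (?X (Suc n)) \<partial>IT.C 0 n (\<lambda>_. undefined))"
      apply simp
      apply (subst emeasure_bind[where N="PiM {0..<Suc n} ?S"])
         apply (simp_all add: IT.space_C[OF un] )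
      using IT.measurable_eP[of n] IT.sets_C[OF un, of n]
      by (metis add_0 measurable_cong_sets)
    also have "\<dots> = (\<integral>\<^sup>+w. emeasure (chain_step M u n x) {x n} * indicator (?X n) w \<partial>IT.C 0 n (\<lambda>_. undefined))"
      by (intro nn_integral_cong step) (simp add: IT.space_C[OF un])
    also have "\<dots> = emeasure (chain_step M u n x) {x n} * emeasure (IT.C 0 n (\<lambda>_. undefined)) (?X n)"
      by (rule nn_integral_cmult_indicator) (use X[of n] IT.sets_C[OF un, of n] in simp)
    finally show ?case using Suc by (simp add: mult.commute)
  qed
  have "{\<omega>. \<forall>k\<le>n. \<omega> k = x k} = prod_emb UNIV ?S {0..<Suc n} (?X (Suc n))"
    by (auto simp: prod_emb_def PiE_iff less_Suc_eq_le space_PiM)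
  then have "emeasure (chain_measure M u) {\<omega>. \<forall>k\<le>n. \<omega> k = x k} = emeasure (IT.CI {0..<Suc n}) (?X (Suc n))"
    unfolding chain_measure_def using IT.lim[OF _ X[of "Suc n"]] by simp
  also have "\<dots> = (\<Prod>k<Suc n. emeasure (chain_step M u k x) {x k})"
    using C[of "Suc n"] IT.emeasure_CI[OF subset_refl X[of "Suc n"]] sets.sets_into_space[OF X[of "Suc n"]]
    by (simp add: prod_emb_id)
  also have "\<dots> = ennreal (pmf (return_pmf u) (x 0) * (\<Prod>k<n. pmf (step_pmf M (x k)) (x (Suc k))))"
    unfolding prod.lessThan_Suc_shift
    by (simp add: chain_step_def emeasure_pmf_single prod_ennreal prod_nonneg ennreal_mult' del: pmf_return emeasure_return_pmf)
  finally show ?thesis .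
qed

text \<open>The infimum of the empty set is \<open>\<infinity>\<close>: the trajectory never reaches \<open>v\<close>.\<close>

definition hitting_time :: "'a \<Rightarrow> (nat \<Rightarrow> 'a) \<Rightarrow> ennreal" where
  "hitting_time v \<omega> = (INF n\<in>{n. \<omega> n = v}. of_nat n)"

text \<open>Expected number of steps from \<open>u\<close> to \<open>v\<close>; the argument is the pair \<open>(v, u)\<close>.\<close>

definition expected_hitting_time :: "'a sqmat \<Rightarrow> 'a \<times> 'a \<Rightarrow> ennreal" where
  "expected_hitting_time M = (\<lambda>(v, u). \<integral>\<^sup>+ \<omega>. hitting_time v \<omega> \<partial>chain_measure M u)"


section \<open>Random walks on graphs\<close>

text \<open>Finite simple undirected graphs are \<^locale>\<open>pair_graph\<close>s: loopless symmetric arc relations.\<close>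

definition adj_mat :: "'a pair_pre_digraph \<Rightarrow> 'a sqmat" where
  "adj_mat G = \<lparr> idx = pverts G, ent = (\<lambda>i j. if (i, j) \<in> parcs G then 1 else 0) \<rparr>"

definition H_srw :: "'a pair_pre_digraph \<Rightarrow> 'a \<times> 'a \<Rightarrow> ennreal" where
  "H_srw G = expected_hitting_time (T_mat (adj_mat G))"

text \<open>Maximal entropy random walk; \<open>\<nu>\<close> is to be the Perron eigenvector of the adjacency matrix.\<close>

definition H_merw :: "'a pair_pre_digraph \<Rightarrow> ('a \<Rightarrow> real) \<Rightarrow> 'a \<times> 'a \<Rightarrow> ennreal" where
  "H_merw G \<nu> =
     expected_hitting_time (T_mat (times_mat (diag_mat (pverts G) \<nu>) (adj_mat G)))"


section \<open>Distance-regularized graphs\<close>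

definition graph_dist :: "'a pair_pre_digraph \<Rightarrow> 'a \<Rightarrow> 'a \<Rightarrow> nat" where
  "graph_dist G u w = (LEAST n. \<exists>p. pre_digraph.awalk (with_proj G) u p w \<and> length p = n)"

definition sphere_at :: "'a pair_pre_digraph \<Rightarrow> nat \<Rightarrow> 'a \<Rightarrow> 'a set" where
  "sphere_at G i u = {w \<in> pverts G. graph_dist G u w = i}"

definition c_num :: "'a pair_pre_digraph \<Rightarrow> 'a \<Rightarrow> 'a \<Rightarrow> nat" where
  "c_num G u w = card (sphere_at G (graph_dist G u w - 1) u \<inter> sphere_at G 1 w)"

definition a_num :: "'a pair_pre_digraph \<Rightarrow> 'a \<Rightarrow> 'a \<Rightarrow> nat" where
  "a_num G u w = card (sphere_at G (graph_dist G u w) u \<inter> sphere_at G 1 w)"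

definition b_num :: "'a pair_pre_digraph \<Rightarrow> 'a \<Rightarrow> 'a \<Rightarrow> nat" where
  "b_num G u w = card (sphere_at G (graph_dist G u w + 1) u \<inter> sphere_at G 1 w)"

definition distance_regularized_vertex :: "'a pair_pre_digraph \<Rightarrow> 'a \<Rightarrow> bool" where
  "distance_regularized_vertex G u \<longleftrightarrow>
     (\<forall>i. \<forall>w\<in>sphere_at G i u. \<forall>w'\<in>sphere_at G i u.
        (1 \<le> i \<longrightarrow> c_num G u w = c_num G u w') \<and>
        a_num G u w = a_num G u w' \<and> b_num G u w = b_num G u w')"

definition distance_regularized_graph :: "'a pair_pre_digraph \<Rightarrow> bool" where
  "distance_regularized_graph G \<longleftrightarrow>
     pair_graph G \<and> Digraph_Component.connected (with_proj G) \<and>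
     (\<forall>u\<in>pverts G. distance_regularized_vertex G u)"

text \<open>The entries of the intersection array: the common values on the spheres around a
  distance-regularized vertex \<open>u\<close>. They are meaningful for \<open>i\<close> up to the eccentricity of \<open>u\<close>,
  and \<open>c_arr\<close> only for \<open>1 \<le> i\<close>.\<close>

definition c_arr :: "'a pair_pre_digraph \<Rightarrow> 'a \<Rightarrow> nat \<Rightarrow> nat" where
  "c_arr G u i = (THE k. \<forall>w\<in>sphere_at G i u. c_num G u w = k)"

definition a_arr :: "'a pair_pre_digraph \<Rightarrow> 'a \<Rightarrow> nat \<Rightarrow> nat" where
  "a_arr G u i = (THE k. \<forall>w\<in>sphere_at G i u. a_num G u w = k)"

definition b_arr :: "'a pair_pre_digraph \<Rightarrow> 'a \<Rightarrow> nat \<Rightarrow> nat" where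
  "b_arr G u i = (THE k. \<forall>w\<in>sphere_at G i u. b_num G u w = k)"

definition eccentricity :: "'a pair_pre_digraph \<Rightarrow> 'a \<Rightarrow> nat" where
  "eccentricity G v = Max (graph_dist G v ` pverts G)"

text \<open>The index \<open>j\<close> stands for the sphere of radius \<open>j\<close> around \<open>v\<close>.\<close>

definition B_mat :: "'a pair_pre_digraph \<Rightarrow> 'a \<Rightarrow> nat sqmat" where
  "B_mat G v = \<lparr> idx = {0..eccentricity G v}, ent = (\<lambda>r j.
     if r + 1 = j then real (c_arr G v j)
     else if r = j then real (a_arr G v j)
     else if r = j + 1 then real (b_arr G v j)
     else 0) \<rparr>"

end

theory Submission
  imports Defs
begin

text \<open>
  Two facts carry the theorem.

  First, the two walks coincide. In a distance-regularized graph all neighbours of a given vertex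
  have the same degree, so the product of the degrees at the ends of an arc is constant on the
  connected graph, and the square roots of the degrees form a positive eigenvector of the adjacency
  matrix. By uniqueness of positive eigenvectors (\<open>positive_eigenvectors_proportional\<close>) the Perron
  eigenvector is a multiple of it, and in particular is constant on the neighbours of each vertex
  (\<open>perron_constant_on_neighbours\<close>). The weights then cancel in the transition probabilities of the
  maximal entropy random walk (\<open>H_merw_eq_H_srw\<close>).

  Second, the distance to \<open>v\<close> turns the simple random walk into the birth-death chain with matrix
  \<open>T_mat (B_mat G v)\<close>: the first-step equations \<open>h w = 1 + (average of h over the neighbours of w)\<close>
  with \<open>h v = 0\<close>, restricted to functions of the distance, are exactly the equations
  \<open>h = 1 + h M\<close> for the quotient matrix \<open>M\<close> without its index \<open>0\<close>. For a birth-death chain they have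
  an explicit nonnegative solution (\<open>ex_birth_death_hitting\<close>), because all \<open>c_arr G v j\<close> with
  \<open>1 \<le> j\<close> up to the eccentricity are positive.

  The two occurrences of this solution are evaluated by one argument, formulated in the locale
  \<open>hitting_vector\<close>: a nonnegative solution of \<open>h = 1 + h M\<close> for a nonnegative matrix \<open>M\<close> bounds the
  partial sums of \<open>\<Sum> M\<^sup>n\<close>. Consequently the Neumann series converges, \<open>M - I\<close> is invertible, and
  \<open>h = 1 \<Sum> M\<^sup>n = - 1 (M - I)\<^sup>-\<^sup>1\<close>. For the quotient chain this identifies \<open>h\<close> with \<open>H_vec\<close>. For the
  walk on the graph, \<open>1 M\<^sup>n\<close> lists the probabilities of not having met \<open>v\<close> up to time \<open>n\<close>, so the
  same series is the expected hitting time (\<open>expected_hitting_time_eq\<close>).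
\<close>

section \<open>Nonnegative matrices with a hitting vector\<close>

definition row_times :: "'i sqmat \<Rightarrow> ('i \<Rightarrow> real) \<Rightarrow> 'i \<Rightarrow> real" where
  "row_times M f j = (\<Sum>i\<in>idx M. f i * ent M i j)"

text \<open>
  Iterating \<open>row_times M\<close> on \<open>indicator {i}\<close> produces row \<open>i\<close> of the powers of \<open>M\<close>, so this is the
  linearity of \<open>f \<mapsto> f M\<^sup>n\<close>. Entries of powers are written in this way throughout.
\<close>

lemma row_power_expand:
  assumes "finite (idx M)" "j \<in> idx M"
  shows "(row_times M ^^ n) f j = (\<Sum>i\<in>idx M. f i * (row_times M ^^ n) (indicator {i}) j)"
  using assms(2)
proof (induction n arbitrary: j)
  case 0
  then show ?case using assms(1)
    by (simp add: indicator_def sum.delta' if_distrib cong: if_cong)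
next
  case (Suc n)
  have "(row_times M ^^ Suc n) f j
      = (\<Sum>k\<in>idx M. (\<Sum>i\<in>idx M. f i * (row_times M ^^ n) (indicator {i}) k) * ent M k j)"
    unfolding funpow.simps comp_apply row_times_def[of M "(row_times M ^^ n) f"]
    by (intro sum.cong refl) (simp only: Suc.IH)
  also have "\<dots> = (\<Sum>i\<in>idx M. f i * (row_times M ^^ Suc n) (indicator {i}) j)"
    unfolding funpow.simps comp_apply row_times_def[of M "(row_times M ^^ n) _"]
    by (simp add: sum_distrib_left sum_distrib_right mult.assoc) (rule sum.swap)
  finally show ?case .
qed

lemma row_power_nonneg:
  assumes "\<And>i j. i \<in> idx M \<Longrightarrow> j \<in> idx M \<Longrightarrow> 0 \<le> ent M i j"
    and "\<And>i. i \<in> idx M \<Longrightarrow> 0 \<le> f i" and "j \<in> idx M"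
  shows "0 \<le> (row_times M ^^ n) f j"
  using assms(3)
  by (induction n arbitrary: j) (auto simp: row_times_def assms intro!: sum_nonneg)

text \<open>
  In terms of the column-substochastic matrix obtained from a chain by deleting the target state,
  \<open>h = 1 + h M\<close> is first-step analysis: \<open>h j\<close> is the expected time to leave the index set from \<open>j\<close>.
  The existence of a nonnegative solution already forces the powers of \<open>M\<close> to be summable, which
  for a chain means that the index set is left almost surely, in finite mean time.
\<close>

locale hitting_vector =
  fixes M :: "'i sqmat" and h :: "'i \<Rightarrow> real"
  assumes finite_idx: "finite (idx M)"
    and ent_nonneg: "i \<in> idx M \<Longrightarrow> j \<in> idx M \<Longrightarrow> 0 \<le> ent M i j"
    and h_nonneg: "j \<in> idx M \<Longrightarrow> 0 \<le> h j"
    and h_eq: "j \<in> idx M \<Longrightarrow> h j = 1 + row_times M h j"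
begin

text \<open>
  Unfolding \<open>h = 1 + h M\<close> \<open>n\<close> times. All terms are nonnegative, so the partial sums of
  \<open>\<Sum> 1 M\<^sup>k\<close> stay below \<open>h\<close>.
\<close>

lemma h_partial_sum:
  assumes "j \<in> idx M"
  shows "h j = (\<Sum>k<n. (row_times M ^^ k) (\<lambda>_. 1) j) + (row_times M ^^ n) h j"
proof (induction n)
  case (Suc n)
  have "(row_times M ^^ n) h j
      = (\<Sum>i\<in>idx M. (1 + row_times M h i) * (row_times M ^^ n) (indicator {i}) j)"
    using row_power_expand[OF finite_idx assms, of n h] h_eq by simp
  also have "\<dots> = (row_times M ^^ n) (\<lambda>_. 1) j + (row_times M ^^ n) (row_times M h) j"
    using row_power_expand[OF finite_idx assms, of n "\<lambda>_. 1"]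
      row_power_expand[OF finite_idx assms, of n "row_times M h"]
    by (simp add: distrib_right sum.distrib)
  finally show ?case
    using Suc by (simp add: funpow_swap1)
qed simp

text \<open>
  The entries of \<open>M\<^sup>n\<close> are summable over \<open>n\<close>, since their column sums are bounded in total by \<open>h\<close>;
  hence they tend to \<open>0\<close>, and so does the remainder \<open>h M\<^sup>n\<close> in the unfolded equation.
\<close>

lemma sums_h:
  assumes j: "j \<in> idx M"
  shows "(\<lambda>n. (row_times M ^^ n) (\<lambda>_. 1) j) sums h j"
    and "i \<in> idx M \<Longrightarrow> summable (\<lambda>n. (row_times M ^^ n) (indicator {i}) j)"
proof -
  let ?e = "\<lambda>i n. (row_times M ^^ n) (indicator {i}) j"
  have one: "(row_times M ^^ n) (\<lambda>_. 1) j = (\<Sum>i\<in>idx M. ?e i n)" for n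
    using row_power_expand[OF finite_idx j, of n "\<lambda>_. 1"] by simp
  have e_nonneg: "0 \<le> ?e i n" for i n
    by (rule row_power_nonneg) (auto simp: ent_nonneg j)
  have summable_e: "summable (?e i)" if i: "i \<in> idx M" for i
  proof (rule bounded_imp_summable)
    show "0 \<le> ?e i n" for n by (rule e_nonneg)
    show "(\<Sum>k\<le>n. ?e i k) \<le> h j" for n
    proof -
      have "(\<Sum>k\<le>n. ?e i k) \<le> (\<Sum>k\<le>n. (row_times M ^^ k) (\<lambda>_. 1) j)"
        unfolding one using finite_idx i e_nonneg by (intro sum_mono member_le_sum) auto
      also have "\<dots> \<le> h j"
        using h_partial_sum[OF j, of "Suc n"] row_power_nonneg[of M h j "Suc n"]
        by (simp add: lessThan_Suc_atMost ent_nonneg h_nonneg j del: funpow.simps)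
      finally show ?thesis .
    qed
  qed
  then show "i \<in> idx M \<Longrightarrow> summable (?e i)" .
  have "(\<lambda>n. \<Sum>i\<in>idx M. h i * ?e i n) \<longlonglongrightarrow> (\<Sum>i\<in>idx M. h i * 0)"
    by (intro tendsto_sum tendsto_mult tendsto_const summable_LIMSEQ_zero summable_e)
  then have "(\<lambda>n. h j - (row_times M ^^ n) h j) \<longlonglongrightarrow> h j - 0"
    by (intro tendsto_intros) (simp add: row_power_expand[OF finite_idx j, of _ h])
  moreover have "h j - (row_times M ^^ n) h j = (\<Sum>k<n. (row_times M ^^ k) (\<lambda>_. 1) j)" for n
    using h_partial_sum[OF j, of n] by linarith
  ultimately show "(\<lambda>n. (row_times M ^^ n) (\<lambda>_. 1) j) sums h j"
    unfolding sums_def by simp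
qed

text \<open>
  The inverse of \<open>M - I\<close> is minus the Neumann series \<open>\<Sum> M\<^sup>n\<close>.
\<close>

lemma invertible: "invertible_sqmat (minus_mat M (id_mat (idx M)))"
proof -
  define N where "N i j = (\<Sum>n. (row_times M ^^ n) (indicator {i}) j)" for i j
  have N_sums: "(\<lambda>n. (row_times M ^^ n) (indicator {i}) j) sums N i j"
    if "i \<in> idx M" "j \<in> idx M" for i j
    unfolding N_def using sums_h(2) that by (simp add: summable_sums)
  have tail: "(\<lambda>n. (row_times M ^^ Suc n) (indicator {i}) j) sums (N i j - (if i = j then 1 else 0))"
    if "i \<in> idx M" "j \<in> idx M" for i j
    using N_sums[OF that] sums_Suc_iff[of "\<lambda>n. (row_times M ^^ n) (indicator {i}) j"]
    by (auto simp: indicator_def simp del: funpow.simps(2))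
  have NM: "(\<Sum>k\<in>idx M. N i k * ent M k j) = N i j - (if i = j then 1 else 0)"
    if "i \<in> idx M" "j \<in> idx M" for i j
  proof -
    have "(\<lambda>n. \<Sum>k\<in>idx M. (row_times M ^^ n) (indicator {i}) k * ent M k j)
        sums (\<Sum>k\<in>idx M. N i k * ent M k j)"
      by (intro sums_sum sums_mult2 N_sums that)
    then show ?thesis
      using sums_unique2 tail[OF that] by (fastforce simp: row_times_def)
  qed
  have MN: "(\<Sum>k\<in>idx M. ent M i k * N k j) = N i j - (if i = j then 1 else 0)"
    if "i \<in> idx M" "j \<in> idx M" for i j
  proof -
    have "row_times M (indicator {i}) = ent M i"
      using that finite_idx by (auto simp: row_times_def indicator_def fun_eq_iff sum.delta' if_distrib cong: if_cong)
    then have shift: "(row_times M ^^ Suc n) (indicator {i}) j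
        = (\<Sum>k\<in>idx M. ent M i k * (row_times M ^^ n) (indicator {k}) j)" for n
      using row_power_expand[OF finite_idx that(2), of n "ent M i"]
      by (simp add: funpow_swap1)
    have "(\<lambda>n. (row_times M ^^ Suc n) (indicator {i}) j) sums (\<Sum>k\<in>idx M. ent M i k * N k j)"
      unfolding shift by (intro sums_sum sums_mult N_sums that)
    then show ?thesis
      using tail[OF that] by (rule sums_unique2)
  qed
  have "(\<Sum>k\<in>idx M. (ent M i k - (if i = k then 1 else 0)) * - N k j) = (if i = j then 1 else 0)"
      "(\<Sum>k\<in>idx M. - N i k * (ent M k j - (if k = j then 1 else 0))) = (if i = j then 1 else 0)"
    if "i \<in> idx M" "j \<in> idx M" for i j
    using that finite_idx NM[OF that] MN[OF that]
    by (simp_all add: left_diff_distrib right_diff_distrib sum_subtractf sum_negf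
        mult_delta_left mult_delta_right)
  then have "is_inverse_mat (minus_mat M (id_mat (idx M))) \<lparr>idx = idx M, ent = (\<lambda>i j. - N i j)\<rparr>"
    by (simp add: is_inverse_mat_def mat_eq_def times_mat_def minus_mat_def id_mat_def)
  then show ?thesis
    unfolding invertible_sqmat_def by blast
qed

text \<open>
  The equation for \<open>h\<close> reads \<open>h (M - I) = - 1\<close>; multiply from the right by whichever inverse
  \<open>inverse_mat\<close> chooses.
\<close>

lemma H_vec_eq:
  assumes x: "x \<in> idx M"
  shows "H_vec M x = h x"
proof -
  let ?A = "minus_mat M (id_mat (idx M))" and ?N = "ent (inverse_mat (minus_mat M (id_mat (idx M))))"
  have "is_inverse_mat ?A (inverse_mat ?A)"
    using invertible unfolding invertible_sqmat_def inverse_mat_def by (rule someI_ex)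
  then have AN: "(\<Sum>k\<in>idx M. ent ?A i k * ?N k x) = (if i = x then 1 else 0)" if "i \<in> idx M" for i
    using that x by (simp add: is_inverse_mat_def mat_eq_def times_mat_def id_mat_def minus_mat_def)
  have hA: "(\<Sum>i\<in>idx M. h i * ent ?A i k) = - 1" if "k \<in> idx M" for k
  proof -
    have "(\<Sum>i\<in>idx M. h i * ent ?A i k) = row_times M h k - h k"
      using that finite_idx
      by (simp add: minus_mat_def id_mat_def row_times_def right_diff_distrib sum_subtractf
          if_distrib[of "\<lambda>x. h _ * x"] cong: if_cong)
    then show ?thesis using h_eq[OF that] by simp
  qed
  have "h x = (\<Sum>i\<in>idx M. h i * (\<Sum>k\<in>idx M. ent ?A i k * ?N k x))"
    using finite_idx x by (simp add: AN if_distrib sum.delta sum.delta' cong: if_cong)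
  also have "\<dots> = (\<Sum>k\<in>idx M. (\<Sum>i\<in>idx M. h i * ent ?A i k) * ?N k x)"
    by (subst sum_distrib_left, subst sum.swap) (simp add: sum_distrib_right mult.assoc)
  also have "\<dots> = H_vec M x"
    by (simp add: hA H_vec_def sum_negf)
  finally show ?thesis by simp
qed

end

section \<open>Expected hitting times of a finite chain\<close>

lemma sets_chain_measure: "sets (chain_measure M u) = sets (PiM UNIV (\<lambda>_. count_space UNIV))"
  and prob_space_chain_measure: "prob_space (chain_measure M u)"
proof -
  let ?S = "\<lambda>_::nat. count_space (UNIV::'a set)"
  interpret IT: Ionescu_Tulcea "chain_step M u" ?S by (rule Ionescu_Tulcea_chain)
  show "sets (chain_measure M u) = sets (PiM UNIV ?S)"
    unfolding chain_measure_def by simp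
  interpret C: prob_space "IT.CI {}" by (rule IT.PF.prob_space_P) auto
  have "emeasure (chain_measure M u) (IT.PF.emb UNIV {} (space (PiM {} ?S)))
      = emeasure (IT.CI {}) (space (IT.CI {}))"
    unfolding chain_measure_def by (subst IT.lim) (auto simp: IT.PF.space_P)
  also have "\<dots> = 1" by (rule C.emeasure_space_1)
  also have "IT.PF.emb UNIV {} (space (PiM {} ?S)) = space (chain_measure M u)"
    unfolding chain_measure_def by (auto simp: prod_emb_def space_PiM)
  finally show "prob_space (chain_measure M u)" by (rule prob_spaceI)
qed

lemma space_chain_measure: "space (chain_measure M u) = UNIV"
  using sets_eq_imp_space_eq[OF sets_chain_measure[of M u]] by (simp add: space_PiM)

lemma sets_chain_coordinates:
  "{\<omega>. \<forall>k\<le>n. P k (\<omega> k)} \<in> sets (chain_measure M u)"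
proof -
  have "(\<lambda>\<omega>. \<omega> k) -` {a. P k a} \<in> sets (chain_measure M u)" for k
  proof -
    have "(\<lambda>\<omega>. \<omega> k) \<in> measurable (chain_measure M u) (count_space UNIV)"
      unfolding measurable_cong_sets[OF sets_chain_measure refl]
      by (rule measurable_component_singleton) simp
    from measurable_sets[OF this, of "{a. P k a}"] show ?thesis
      by (simp add: space_chain_measure)
  qed
  then have "(\<Inter>k\<in>{..n}. (\<lambda>\<omega>. \<omega> k) -` {a. P k a}) \<in> sets (chain_measure M u)"
    by (intro sets.finite_INT) auto
  also have "(\<Inter>k\<in>{..n}. (\<lambda>\<omega>. \<omega> k) -` {a. P k a}) = {\<omega>. \<forall>k\<le>n. P k (\<omega> k)}"
    by auto
  finally show ?thesis .
qed

lemma sum_PiE_insert: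
  assumes "a \<notin> S"
  shows "sum F (PiE (insert a S) T) = (\<Sum>y\<in>T a. \<Sum>g\<in>PiE S T. F (g(a := y)))"
  unfolding PiE_insert_eq using inj_combinator[OF assms, of T]
  by (simp add: sum.reindex sum.cartesian_product case_prod_unfold)

text \<open>
  Summing over the last state of the path first turns a sum of weights \<open>g\<close> into a sum of weights
  \<open>row_times N g\<close> over paths that are one step shorter. Only transitions inside \<open>W\<close> matter, so \<open>N\<close>
  may be a proper submatrix of the transition matrix.
\<close>

lemma path_sum_eq_row_power:
  assumes "finite W" "idx N = W" "u \<in> W"
    and step: "\<And>y z. y \<in> W \<Longrightarrow> z \<in> W \<Longrightarrow> pmf (step_pmf M z) y = ent N y z"
  shows "(\<Sum>x\<in>PiE {..n} (\<lambda>_. W). pmf (return_pmf u) (x 0)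
            * (\<Prod>k<n. pmf (step_pmf M (x k)) (x (Suc k))) * g (x n))
      = (row_times N ^^ n) g u"
proof (induction n arbitrary: g)
  case 0
  have "{..0::nat} = insert 0 {}" by auto
  then show ?case
    using assms(1,3) by (simp add: sum_PiE_insert if_distrib sum.delta' indicator_def cong: if_cong)
next
  case (Suc n)
  let ?p = "\<lambda>n x. pmf (return_pmf u) (x 0) * (\<Prod>k<n. pmf (step_pmf M (x k)) (x (Suc k)))"
  have "(\<Sum>x\<in>PiE {..Suc n} (\<lambda>_. W). ?p (Suc n) x * g (x (Suc n)))
      = (\<Sum>y\<in>W. \<Sum>x\<in>PiE {..n} (\<lambda>_. W). ?p n x * (g y * ent N y (x n)))"
    unfolding atMost_Suc by (subst sum_PiE_insert) (auto intro!: sum.cong simp: step PiE_iff)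
  also have "\<dots> = (\<Sum>x\<in>PiE {..n} (\<lambda>_. W). ?p n x * row_times N g (x n))"
    by (subst sum.swap) (simp add: row_times_def assms(2) sum_distrib_left)
  also have "\<dots> = (row_times N ^^ Suc n) g u"
    by (simp only: Suc.IH funpow_Suc_right comp_apply)
  finally show ?case .
qed

lemma emeasure_chain_stays:
  assumes "finite W" "idx N = W" "u \<in> W"
    and step: "\<And>y z. y \<in> W \<Longrightarrow> z \<in> W \<Longrightarrow> pmf (step_pmf M z) y = ent N y z"
  shows "emeasure (chain_measure M u) {\<omega>. \<forall>k\<le>n. \<omega> k \<in> W} = ennreal ((row_times N ^^ n) (\<lambda>_. 1) u)"
proof -
  let ?X = "PiE {..n} (\<lambda>_. W)" and ?cyl = "\<lambda>x. {\<omega>. \<forall>k\<le>n. \<omega> k = x k}"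
  have "{\<omega>. \<forall>k\<le>n. \<omega> k \<in> W} = (\<Union>x\<in>?X. ?cyl x)"
  proof (intro set_eqI iffI)
    fix \<omega> assume "\<omega> \<in> {\<omega>. \<forall>k\<le>n. \<omega> k \<in> W}"
    then show "\<omega> \<in> (\<Union>x\<in>?X. ?cyl x)"
      by (intro UN_I[of "restrict \<omega> {..n}"]) auto
  qed (auto simp: PiE_iff)
  moreover have "disjoint_family_on ?cyl ?X"
    unfolding disjoint_family_on_def
  proof (intro ballI impI equals0I)
    fix x x' \<omega> assume "x \<in> ?X" "x' \<in> ?X" "x \<noteq> x'" and \<omega>: "\<omega> \<in> ?cyl x \<inter> ?cyl x'"
    have "x = x'"
      by (rule PiE_ext[OF \<open>x \<in> ?X\<close> \<open>x' \<in> ?X\<close>]) (use \<omega> in auto)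
    with \<open>x \<noteq> x'\<close> show False by simp
  qed
  moreover have "?cyl x \<in> sets (chain_measure M u)" for x
    by (rule sets_chain_coordinates[where P="\<lambda>k a. a = x k"])
  then have "?cyl ` ?X \<subseteq> sets (chain_measure M u)" by (rule image_subsetI)
  ultimately have "emeasure (chain_measure M u) {\<omega>. \<forall>k\<le>n. \<omega> k \<in> W}
      = (\<Sum>x\<in>?X. emeasure (chain_measure M u) (?cyl x))"
    using assms(1) by (simp add: sum_emeasure finite_PiE)
  also have "\<dots> = ennreal (\<Sum>x\<in>?X. pmf (return_pmf u) (x 0)
      * (\<Prod>k<n. pmf (step_pmf M (x k)) (x (Suc k))))"
    by (simp add: chain_cylinder sum_ennreal prod_nonneg del: pmf_return)
  also have "\<dots> = ennreal ((row_times N ^^ n) (\<lambda>_. 1) u)"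
    using path_sum_eq_row_power[OF assms, of n "\<lambda>_. 1"] by (simp del: pmf_return)
  finally show ?thesis .
qed

text \<open>
  A natural number is the number of naturals below it; in this form the expectation becomes
  the sum of the tail probabilities, with no case distinction for trajectories that miss \<open>v\<close>.
\<close>

lemma hitting_time_eq_suminf:
  "hitting_time v \<omega> = (\<Sum>n. indicator {\<omega>. \<forall>k\<le>n. \<omega> k \<noteq> v} \<omega>)"
proof (cases "\<exists>n. \<omega> n = v")
  case False
  then have "hitting_time v \<omega> = top" by (simp add: hitting_time_def)
  moreover have "(\<Sum>n. indicator {\<omega>. \<forall>k\<le>n. \<omega> k \<noteq> v} \<omega> :: ennreal) = top"
    using False by (simp add: suminf_eq_SUP ennreal_SUP_of_nat_eq_top)
  ultimately show ?thesis by simp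
next
  case True
  define m where "m = (LEAST n. \<omega> n = v)"
  have m: "\<omega> m = v" "\<And>n. \<omega> n = v \<Longrightarrow> m \<le> n"
    unfolding m_def using True by (auto intro: LeastI_ex Least_le)
  have "hitting_time v \<omega> = of_nat m"
    unfolding hitting_time_def using m by (intro antisym INF_lower INF_greatest) auto
  moreover have "(\<forall>k\<le>n. \<omega> k \<noteq> v) \<longleftrightarrow> n < m" for n
    using m by (metis le_trans not_le order_refl)
  then have "indicator {\<omega>. \<forall>k\<le>n. \<omega> k \<noteq> v} \<omega> = (if n < m then 1 else 0 :: ennreal)" for n
    by (simp add: indicator_def)
  then have "(\<Sum>n. indicator {\<omega>. \<forall>k\<le>n. \<omega> k \<noteq> v} \<omega> :: ennreal) = (\<Sum>n<m. 1)"
    by (subst suminf_finite[of "{..<m}"]) auto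
  ultimately show ?thesis by simp
qed

text \<open>
  The probability of avoiding \<open>v\<close> up to time \<open>n\<close> is the column sum at \<open>u\<close> of the \<open>n\<close>-th power of the
  transition matrix without \<open>v\<close>, and these column sums add up to \<open>h u\<close>.
\<close>

lemma expected_hitting_time_eq:
  assumes fin: "finite (idx M)" and nonneg: "\<And>x y. x \<in> idx M \<Longrightarrow> y \<in> idx M \<Longrightarrow> 0 \<le> ent M x y"
    and stoch: "\<And>y. y \<in> idx M \<Longrightarrow> (\<Sum>x\<in>idx M. ent M x y) = 1"
    and hit: "hitting_vector (del_mat M v) h"
    and u: "u \<in> idx M" "u \<noteq> v"
  shows "expected_hitting_time M (v, u) = ennreal (h u)"
proof -
  interpret prob_space "chain_measure M u" by (rule prob_space_chain_measure)
  interpret hv: hitting_vector "del_mat M v" h by (rule hit)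
  let ?W = "idx M - {v}"
  let ?q = "\<lambda>n. (row_times (del_mat M v) ^^ n) (\<lambda>_. 1) u"
  have step: "pmf (step_pmf M z) y = ent M y z" if "y \<in> idx M" "z \<in> idx M" for y z
    using that nonneg stoch fin by (subst pmf_step_pmf) auto
  have row_one: "(row_times M ^^ n) (\<lambda>_. 1) z = 1" if "z \<in> idx M" for n z
    using that by (induction n arbitrary: z) (simp_all add: row_times_def stoch)
  \<comment> \<open>The ambient type may be larger than the state space, so avoiding \<open>v\<close> and staying in the
    states other than \<open>v\<close> agree only up to a null set.\<close>
  have surv: "emeasure (chain_measure M u) {\<omega>. \<forall>k\<le>n. \<omega> k \<noteq> v} = ennreal (?q n)" for n
  proof -
    have "emeasure (chain_measure M u) {\<omega>. \<forall>k\<le>n. \<omega> k \<in> idx M} = 1"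
      using emeasure_chain_stays[OF fin refl u(1) step, of n] row_one[OF u(1), of n] by simp
    then have "AE \<omega> in chain_measure M u. \<omega> \<in> {\<omega>. \<forall>k\<le>n. \<omega> k \<in> idx M}"
      using sets_chain_coordinates[where P="\<lambda>_ a. a \<in> idx M"]
      by (subst AE_in_set_eq_1) (simp_all add: emeasure_eq_measure)
    then have "emeasure (chain_measure M u) {\<omega>. \<forall>k\<le>n. \<omega> k \<noteq> v}
        = emeasure (chain_measure M u) {\<omega>. \<forall>k\<le>n. \<omega> k \<in> ?W}"
      using sets_chain_coordinates[where P="\<lambda>_ a. a \<noteq> v"] sets_chain_coordinates[where P="\<lambda>_ a. a \<in> ?W"]
      by (intro emeasure_eq_AE) (auto elim: eventually_mono)
    also have "\<dots> = ennreal (?q n)"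
      using fin u by (intro emeasure_chain_stays) (auto simp: del_mat_def step)
    finally show ?thesis .
  qed
  have meas: "{\<omega>. \<forall>k\<le>n. \<omega> k \<noteq> v} \<in> sets (chain_measure M u)" for n
    by (rule sets_chain_coordinates[where P="\<lambda>_ a. a \<noteq> v"])
  have "expected_hitting_time M (v, u)
      = (\<integral>\<^sup>+ \<omega>. (\<Sum>n. indicator {\<omega>. \<forall>k\<le>n. \<omega> k \<noteq> v} \<omega>) \<partial>chain_measure M u)"
    by (simp only: expected_hitting_time_def case_prod_conv hitting_time_eq_suminf)
  also have "\<dots> = (\<Sum>n. emeasure (chain_measure M u) {\<omega>. \<forall>k\<le>n. \<omega> k \<noteq> v})"
    by (subst nn_integral_suminf) (intro borel_measurable_indicator meas, simp only: nn_integral_indicator[OF meas])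
  also have "\<dots> = (\<Sum>n. ennreal (?q n))"
    by (simp add: surv)
  also have "\<dots> = ennreal (h u)"
  proof (rule suminf_ennreal_eq)
    have u': "u \<in> idx (del_mat M v)" using u by (simp add: del_mat_def)
    show "?q sums h u" by (rule hv.sums_h(1)[OF u'])
    show "0 \<le> ?q n" for n
      by (rule row_power_nonneg[OF hv.ent_nonneg _ u']) auto
  qed
  finally show ?thesis .
qed

section \<open>Distances and intersection numbers\<close>

definition neighbours :: "'a pair_pre_digraph \<Rightarrow> 'a \<Rightarrow> 'a set" where
  "neighbours G w = {x. (w, x) \<in> parcs G}"

locale connected_pair_graph = pair_graph +
  assumes connected: "Digraph_Component.connected (with_proj G)"
begin

lemma parcs_sym: "(x, y) \<in> parcs G \<Longrightarrow> (y, x) \<in> parcs G"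
  using pair_sym_arcs by (auto simp: symmetric_def dest: symD)

lemma finite_neighbours: "finite (neighbours G w)"
  by (rule finite_subset[OF _ pair_finite_verts]) (auto simp: neighbours_def dest: in_arcsD2)

lemma sum_over_neighbours:
  fixes f :: "'a \<Rightarrow> real"
  shows "(\<Sum>x\<in>pverts G. (if (w, x) \<in> parcs G then 1 else 0) * f x) = (\<Sum>x\<in>neighbours G w. f x)"
proof -
  have "(\<Sum>x\<in>pverts G. (if (w, x) \<in> parcs G then 1 else 0) * f x)
      = (\<Sum>x\<in>pverts G. if x \<in> neighbours G w then f x else 0)"
    by (intro sum.cong) (auto simp: neighbours_def)
  also have "\<dots> = (\<Sum>x\<in>pverts G \<inter> neighbours G w. f x)"
    using pair_finite_verts by (simp add: sum.inter_restrict)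
  also have "pverts G \<inter> neighbours G w = neighbours G w"
    using in_arcsD2 by (auto simp: neighbours_def)
  finally show ?thesis .
qed

lemma ex_awalk:
  assumes "u \<in> pverts G" "w \<in> pverts G"
  shows "\<exists>p. awalk u p w"
  using symmetric_connected_imp_strongly_connected[OF pair_sym_arcs connected] assms
  by (auto simp: strongly_connected_def reachable_awalk)

text \<open>
  Connectedness as an induction principle: a property that spreads along arcs is global.
\<close>

lemma arc_induct:
  assumes "u \<in> pverts G" "P u" and "\<And>x y. (x, y) \<in> parcs G \<Longrightarrow> P x \<Longrightarrow> P y"
    and "w \<in> pverts G"
  shows "P w"
proof -
  obtain p where "awalk u p w" using ex_awalk assms(1,4) by blast
  then show ?thesis
    using assms(2)
  proof (induction p arbitrary: u)
    case (Cons e p)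
    then show ?case using assms(3)[of "fst e" "snd e"] by (auto simp: awalk_Cons_iff)
  qed (simp add: awalk_Nil_iff)
qed

lemma graph_dist_le: "awalk u p w \<Longrightarrow> graph_dist G u w \<le> length p"
  unfolding graph_dist_def by (rule Least_le) blast

lemma geodesic:
  assumes "u \<in> pverts G" "w \<in> pverts G"
  obtains p where "awalk u p w" "length p = graph_dist G u w"
proof -
  have "\<exists>p. awalk u p w \<and> length p = graph_dist G u w"
    unfolding graph_dist_def using ex_awalk[OF assms]
    by (intro LeastI_ex[of "\<lambda>n. \<exists>p. awalk u p w \<and> length p = n"]) blast
  then show thesis using that by blast
qed

lemma graph_dist_eq_0:
  assumes "u \<in> pverts G" "w \<in> pverts G"
  shows "graph_dist G u w = 0 \<longleftrightarrow> u = w"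
proof
  assume "graph_dist G u w = 0"
  then show "u = w" using geodesic[OF assms] by (metis awalk_empty_ends length_0_conv)
next
  assume "u = w"
  then show "graph_dist G u w = 0" using graph_dist_le[of u "[]" w] assms by (simp add: awalk_Nil_iff)
qed

lemma graph_dist_step:
  assumes "u \<in> pverts G" "(w, x) \<in> parcs G"
  shows "graph_dist G u x \<le> graph_dist G u w + 1"
proof -
  obtain p where p: "awalk u p w" "length p = graph_dist G u w"
    using geodesic assms in_arcsD1 by blast
  have "awalk u (p @ [(w, x)]) x"
  proof (rule awalk_appendI[OF p(1)])
    show "awalk w [(w, x)] x"
      using assms(2) in_arcsD2[OF assms(2)] by (simp add: awalk_Cons_iff awalk_Nil_iff)
  qed
  from graph_dist_le[OF this] p(2) show ?thesis by simp
qed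

lemma graph_dist_predecessor:
  assumes "u \<in> pverts G" "w \<in> pverts G" "graph_dist G u w = Suc n"
  obtains x where "(x, w) \<in> parcs G" "graph_dist G u x = n"
proof -
  obtain p where p: "awalk u p w" "length p = Suc n"
    using geodesic assms by metis
  then obtain q e where q: "p = q @ [e]" "length q = n"
    by (metis length_Suc_conv_rev)
  then have e: "e \<in> parcs G" "snd e = w" "awalk u q (fst e)"
    using p(1) by (auto simp: awalk_Cons_iff awalk_Nil_iff)
  then have arc: "(fst e, w) \<in> parcs G" by (metis prod.collapse)
  have "graph_dist G u (fst e) = n"
    using graph_dist_le[OF e(3)] graph_dist_step[OF assms(1) arc] q(2) assms(3) by simp
  with arc show thesis by (rule that)
qed

lemma sphere_one_eq_neighbours:
  assumes "w \<in> pverts G"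
  shows "sphere_at G 1 w = neighbours G w"
proof (intro set_eqI iffI)
  fix x assume "x \<in> sphere_at G 1 w"
  then have x: "x \<in> pverts G" "graph_dist G w x = Suc 0" by (auto simp: sphere_at_def)
  then obtain y where "(y, x) \<in> parcs G" "graph_dist G w y = 0"
    using graph_dist_predecessor assms by blast
  then show "x \<in> neighbours G w"
    using graph_dist_eq_0[OF assms] in_arcsD1 by (auto simp: neighbours_def)
next
  fix x assume "x \<in> neighbours G w"
  then have arc: "(w, x) \<in> parcs G" by (simp add: neighbours_def)
  have "x \<in> pverts G" "x \<noteq> w" using in_arcsD2[OF arc] pair_no_loops[OF arc] by auto
  moreover have "graph_dist G w w = 0" using graph_dist_eq_0 assms by blast
  ultimately show "x \<in> sphere_at G 1 w"
    using graph_dist_step[OF assms arc] graph_dist_eq_0[OF assms, of x] by (auto simp: sphere_at_def)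
qed

lemma neighbours_nonempty:
  assumes "w \<in> pverts G" "x \<in> pverts G" "w \<noteq> x"
  shows "neighbours G w \<noteq> {}"
proof -
  obtain n where "graph_dist G x w = Suc n"
    using graph_dist_eq_0[OF assms(2,1)] assms(3) by (metis not0_implies_Suc)
  then obtain y where "(y, w) \<in> parcs G"
    using graph_dist_predecessor assms by blast
  then show ?thesis using parcs_sym by (auto simp: neighbours_def)
qed

text \<open>
  The point of the intersection numbers: a radial function, summed over the neighbours of \<open>w\<close>,
  depends on \<open>w\<close> only through them, as distances to \<open>v\<close> change by at most one along an arc.
\<close>

lemma sum_neighbours_by_distance:
  fixes g :: "nat \<Rightarrow> real"
  assumes v: "v \<in> pverts G" and w: "w \<in> pverts G" "w \<noteq> v"
  defines "i \<equiv> graph_dist G v w"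
  shows "(\<Sum>x\<in>neighbours G w. g (graph_dist G v x))
    = c_num G v w * g (i - 1) + a_num G v w * g i + b_num G v w * g (i + 1)"
proof -
  let ?S = "\<lambda>k. sphere_at G k v \<inter> sphere_at G 1 w"
  have i: "1 \<le> i" using graph_dist_eq_0[OF v w(1)] w(2) by (auto simp: i_def Suc_le_eq)
  have fin: "finite (?S k)" for k
    using sphere_one_eq_neighbours[OF w(1)] finite_neighbours by simp
  have const: "(\<Sum>x\<in>?S k. g (graph_dist G v x)) = card (?S k) * g k" for k
    by (simp add: sphere_at_def)
  have "neighbours G w = ?S (i - 1) \<union> ?S i \<union> ?S (i + 1)"
  proof (intro set_eqI iffI)
    fix x assume x: "x \<in> neighbours G w"
    then have "graph_dist G v x \<le> i + 1" "i \<le> graph_dist G v x + 1" "x \<in> pverts G"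
      using graph_dist_step[OF v] parcs_sym in_arcsD2 by (auto simp: neighbours_def i_def)
    then have "graph_dist G v x \<in> {i - 1, i, i + 1}" by auto
    with x \<open>x \<in> pverts G\<close> show "x \<in> ?S (i - 1) \<union> ?S i \<union> ?S (i + 1)"
      unfolding sphere_one_eq_neighbours[OF w(1)] by (auto simp: sphere_at_def)
  qed (use sphere_one_eq_neighbours[OF w(1)] in auto)
  moreover have "?S (i - 1) \<inter> ?S i = {}" "(?S (i - 1) \<union> ?S i) \<inter> ?S (i + 1) = {}"
    using i by (auto simp: sphere_at_def)
  ultimately have "(\<Sum>x\<in>neighbours G w. g (graph_dist G v x))
      = (\<Sum>x\<in>?S (i - 1). g (graph_dist G v x)) + (\<Sum>x\<in>?S i. g (graph_dist G v x))
        + (\<Sum>x\<in>?S (i + 1). g (graph_dist G v x))"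
    using fin by (simp add: sum.union_disjoint)
  then show ?thesis
    unfolding const by (simp add: c_num_def a_num_def b_num_def i_def)
qed

lemma card_neighbours_eq:
  assumes "v \<in> pverts G" "w \<in> pverts G" "w \<noteq> v"
  shows "card (neighbours G w) = c_num G v w + a_num G v w + b_num G v w"
  using sum_neighbours_by_distance[OF assms, of "\<lambda>_. 1"]
  by (simp flip: of_nat_add)

lemma c_num_pos:
  assumes "v \<in> pverts G" "w \<in> pverts G" "w \<noteq> v"
  shows "0 < c_num G v w"
proof -
  obtain n where n: "graph_dist G v w = Suc n"
    using graph_dist_eq_0[OF assms(1,2)] assms(3) by (metis not0_implies_Suc)
  then obtain x where "(x, w) \<in> parcs G" "graph_dist G v x = n"
    using graph_dist_predecessor assms by blast
  then have "x \<in> sphere_at G (graph_dist G v w - 1) v \<inter> sphere_at G 1 w"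
    using n in_arcsD1 parcs_sym unfolding sphere_one_eq_neighbours[OF assms(2)]
    by (auto simp: sphere_at_def neighbours_def)
  then show ?thesis
    using sphere_one_eq_neighbours[OF assms(2)] finite_neighbours
    by (auto simp: c_num_def card_gt_0_iff)
qed

lemma graph_dist_le_eccentricity: "w \<in> pverts G \<Longrightarrow> graph_dist G v w \<le> eccentricity G v"
  unfolding eccentricity_def using pair_finite_verts by (intro Max_ge) auto

lemma sphere_nonempty:
  assumes v: "v \<in> pverts G" and "i \<le> eccentricity G v"
  shows "sphere_at G i v \<noteq> {}"
  using assms(2)
proof (induction rule: inc_induct)
  case base
  have "eccentricity G v \<in> graph_dist G v ` pverts G"
    unfolding eccentricity_def using pair_finite_verts v by (intro Max_in) auto
  then show ?case by (auto simp: sphere_at_def)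
next
  case (step n)
  then obtain w where "w \<in> pverts G" "graph_dist G v w = Suc n" by (auto simp: sphere_at_def)
  then obtain x where "(x, w) \<in> parcs G" "graph_dist G v x = n"
    using graph_dist_predecessor[OF v] by blast
  then have "x \<in> sphere_at G n v" using in_arcsD1 by (simp add: sphere_at_def)
  then show ?case by blast
qed

lemma b_num_eccentricity:
  assumes "graph_dist G v w = eccentricity G v"
  shows "b_num G v w = 0"
proof -
  have "sphere_at G (graph_dist G v w + 1) v = {}"
    using graph_dist_le_eccentricity[of _ v] assms by (fastforce simp: sphere_at_def)
  then show ?thesis by (simp add: b_num_def)
qed

lemma intersection_array_eq:
  assumes "distance_regularized_vertex G v" "w \<in> sphere_at G i v"
  shows "1 \<le> i \<Longrightarrow> c_arr G v i = c_num G v w" "a_arr G v i = a_num G v w" "b_arr G v i = b_num G v w"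
proof -
  have same: "(1 \<le> i \<longrightarrow> c_num G v w' = c_num G v w) \<and> a_num G v w' = a_num G v w \<and> b_num G v w' = b_num G v w"
    if "w' \<in> sphere_at G i v" for w'
    using assms that unfolding distance_regularized_vertex_def by blast
  show "c_arr G v i = c_num G v w" if "1 \<le> i"
    unfolding c_arr_def by (rule the_equality) (use same assms(2) that in metis)+
  show "a_arr G v i = a_num G v w"
    unfolding a_arr_def by (rule the_equality) (use same assms(2) in metis)+
  show "b_arr G v i = b_num G v w"
    unfolding b_arr_def by (rule the_equality) (use same assms(2) in metis)+
qed

section \<open>The Perron eigenvector of a distance-regularized graph\<close>

text \<open>
  The part of the Perron-Frobenius theorem that is needed. Symmetry of the adjacency matrix makes
  the two eigenvalues equal. If \<open>r\<close> is the least ratio \<open>g w / f w\<close>, then \<open>g - r f\<close> is a nonnegative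
  solution of the eigenvalue equation with a zero, and a zero at a vertex spreads to all its
  neighbours.
\<close>

lemma positive_eigenvectors_proportional:
  assumes f: "\<And>w. w \<in> pverts G \<Longrightarrow> 0 < f w"
      "\<And>w. w \<in> pverts G \<Longrightarrow> (\<Sum>x\<in>neighbours G w. f x) = s * f w"
    and g: "\<And>w. w \<in> pverts G \<Longrightarrow> 0 < g w"
      "\<And>w. w \<in> pverts G \<Longrightarrow> (\<Sum>x\<in>neighbours G w. g x) = t * g w"
  obtains r :: real where "\<And>w. w \<in> pverts G \<Longrightarrow> g w = r * f w"
proof (cases "pverts G = {}")
  case False
  note fin = pair_finite_verts
  let ?A = "\<lambda>w x. if (w, x) \<in> parcs G then 1 else 0 :: real"
  note A = sum_over_neighbours
  have "t * (\<Sum>w\<in>pverts G. f w * g w) = (\<Sum>w\<in>pverts G. \<Sum>x\<in>pverts G. f w * (?A w x * g x))"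
    by (simp add: A g(2) sum_distrib_left[symmetric] mult.left_commute)
  also have "\<dots> = (\<Sum>x\<in>pverts G. \<Sum>w\<in>pverts G. g x * (?A x w * f w))"
    using parcs_sym by (subst sum.swap) (auto intro!: sum.cong)
  also have "\<dots> = (\<Sum>x\<in>pverts G. g x * (s * f x))"
    by (simp only: sum_distrib_left[symmetric] A f(2) cong: sum.cong)
  also have "\<dots> = s * (\<Sum>w\<in>pverts G. f w * g w)"
    by (simp add: sum_distrib_left mult_ac)
  finally have "t = s"
    using sum_pos[OF fin False, of "\<lambda>w. f w * g w"] f(1) g(1) by simp
  define r where "r = Min ((\<lambda>w. g w / f w) ` pverts G)"
  have "r \<in> (\<lambda>w. g w / f w) ` pverts G"
    unfolding r_def using fin False by (intro Min_in) auto
  then obtain w0 where w0: "w0 \<in> pverts G" "g w0 = r * f w0"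
    using f(1) by (force simp: field_simps)
  have le: "r * f w \<le> g w" if "w \<in> pverts G" for w
    using f(1)[OF that] that fin Min_le[of "(\<lambda>w. g w / f w) ` pverts G" "g w / f w"]
    by (simp add: r_def[symmetric] pos_le_divide_eq)
  have "g w = r * f w" if "w \<in> pverts G" for w
  proof (rule arc_induct[OF w0(1) _ _ that])
    fix x y assume xy: "(x, y) \<in> parcs G" "g x = r * f x"
    have x: "x \<in> pverts G" using in_arcsD1 xy(1) by blast
    have "(\<Sum>z\<in>neighbours G x. g z - r * f z) = 0"
      by (simp add: sum_subtractf sum_distrib_left[symmetric] f(2) g(2) x xy(2) \<open>t = s\<close>)
    moreover have "0 \<le> g z - r * f z" if "z \<in> neighbours G x" for z
      using le that in_arcsD2 by (auto simp: neighbours_def)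
    ultimately have "g y - r * f y = 0"
      using xy(1) finite_neighbours by (subst (asm) sum_nonneg_eq_0_iff) (auto simp: neighbours_def)
    then show "g y = r * f y" by simp
  qed (rule w0(2))
  then show thesis by (rule that)
qed simp

text \<open>
  Distance-regularity at \<open>w\<close> gives all neighbours of \<open>w\<close> the same degree. Hence the product of the
  degrees of the two ends of an arc is the same number \<open>P\<close> for all arcs (two arcs with a common end
  have equal products, and the graph is connected), and \<open>w \<mapsto> sqrt (deg w)\<close> is a positive
  eigenvector for the eigenvalue \<open>sqrt P\<close>. The Perron eigenvector is a multiple of it. This covers
  the regular and the bipartite semiregular case at once.
\<close>

lemma perron_constant_on_neighbours:
  fixes \<nu> :: "'a \<Rightarrow> real"
  assumes reg: "\<And>u. u \<in> pverts G \<Longrightarrow> distance_regularized_vertex G u"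
    and \<nu>: "\<And>w. w \<in> pverts G \<Longrightarrow> 0 < \<nu> w"
      "\<And>w. w \<in> pverts G \<Longrightarrow> (\<Sum>x\<in>neighbours G w. \<nu> x) = t * \<nu> w"
    and xy: "x \<in> neighbours G w" "y \<in> neighbours G w"
  shows "\<nu> x = \<nu> y"
proof -
  let ?d = "\<lambda>w. real (card (neighbours G w))"
  have deg: "?d x = ?d y" if "x \<in> neighbours G w" "y \<in> neighbours G w" for w x y
  proof -
    have w: "w \<in> pverts G" using that in_arcsD1 by (auto simp: neighbours_def)
    have *: "x \<in> pverts G" "y \<in> pverts G" "x \<noteq> w" "y \<noteq> w"
      using that in_arcsD2 pair_no_loops by (fastforce simp: neighbours_def)+
    have "x \<in> sphere_at G 1 w" "y \<in> sphere_at G 1 w"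
      using that sphere_one_eq_neighbours[OF w] by simp_all
    then have "c_num G w x = c_num G w y \<and> a_num G w x = a_num G w y \<and> b_num G w x = b_num G w y"
      using reg[OF w] unfolding distance_regularized_vertex_def by blast
    then show ?thesis
      using card_neighbours_eq[OF w] * by simp
  qed
  have w: "w \<in> pverts G" using xy in_arcsD1 by (auto simp: neighbours_def)
  let ?P = "?d w * ?d x"
  have prod: "\<forall>z\<in>neighbours G w'. ?d w' * ?d z = ?P" if "w' \<in> pverts G" for w'
  proof (rule arc_induct[OF w _ _ that])
    show "\<forall>z\<in>neighbours G w. ?d w * ?d z = ?P"
      using deg xy by metis
  next
    fix a b assume ab: "(a, b) \<in> parcs G" "\<forall>z\<in>neighbours G a. ?d a * ?d z = ?P"
    then have "a \<in> neighbours G b" "?d a * ?d b = ?P" using parcs_sym by (auto simp: neighbours_def)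
    then show "\<forall>z\<in>neighbours G b. ?d b * ?d z = ?P"
      using deg by (metis mult.commute)
  qed
  have nonempty: "neighbours G z \<noteq> {}" if "z \<in> pverts G" for z
    using neighbours_nonempty[OF that] xy w in_arcsD2 pair_no_loops[of "(w, x)"]
    by (metis fst_conv mem_Collect_eq neighbours_def snd_conv)
  have "(\<Sum>x\<in>neighbours G z. sqrt (?d x)) = sqrt ?P * sqrt (?d z)" if z: "z \<in> pverts G" for z
  proof -
    obtain a where a: "a \<in> neighbours G z" using nonempty[OF z] by blast
    have "(\<Sum>x\<in>neighbours G z. sqrt (?d x)) = (\<Sum>x\<in>neighbours G z. sqrt (?d a))"
      using deg[OF _ a] by (intro sum.cong) auto
    also have "\<dots> = sqrt (?d z * ?d a) * sqrt (?d z)"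
      by (simp add: real_sqrt_mult)
    also have "?d z * ?d a = ?P" using prod[OF z] a by blast
    finally show ?thesis .
  qed
  moreover have "0 < sqrt (?d z)" if "z \<in> pverts G" for z
    using nonempty[OF that] finite_neighbours by (simp add: card_gt_0_iff)
  ultimately obtain r where "\<And>z. z \<in> pverts G \<Longrightarrow> \<nu> z = r * sqrt (?d z)"
    using positive_eigenvectors_proportional[of "\<lambda>z. sqrt (?d z)" "sqrt ?P" \<nu> t] \<nu> by blast
  then show ?thesis
    using deg[OF xy] xy in_arcsD2 by (auto simp: neighbours_def)
qed

end

section \<open>Hitting the origin in a birth-death chain\<close>

text \<open>
  The increments \<open>\<delta> i = h i - h (i - 1)\<close> satisfy \<open>c i * \<delta> i = (c i + a i + b i) + b i * \<delta> (i + 1)\<close>.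
  They are therefore determined by downward recursion from \<open>d\<close>, and visibly nonnegative.
\<close>

lemma ex_birth_death_hitting:
  fixes c a b :: "nat \<Rightarrow> real"
  assumes c: "\<And>i. i \<in> {1..d} \<Longrightarrow> 0 < c i" and nonneg: "\<And>i. 0 \<le> a i" "\<And>i. 0 \<le> b i" "\<And>i. 0 \<le> c i"
  obtains h where "h 0 = 0" "\<And>i. 0 \<le> h i"
    "\<And>i. i \<in> {1..d} \<Longrightarrow> (c i + a i + b i) * h i
        = (c i + a i + b i) + (c i * h (i - 1) + a i * h i + b i * h (i + 1))"
proof -
  \<comment> \<open>\<open>e n\<close> is the increment \<open>\<delta> (Suc d - n)\<close>: the recursion runs downward, from \<open>\<delta> (d + 1) = 0\<close>.\<close>
  define e where "e = rec_nat 0 (\<lambda>n x. (c (d - n) + a (d - n) + b (d - n) + b (d - n) * x) / c (d - n))"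
  have e: "e (Suc n) = (c (d - n) + a (d - n) + b (d - n) + b (d - n) * e n) / c (d - n)" for n
    by (simp add: e_def)
  have e_nonneg: "0 \<le> e n" for n
    by (induction n) (simp_all add: e nonneg, simp add: e_def)
  define h where "h i = (\<Sum>k\<in>{1..i}. e (Suc d - k))" for i
  have h_Suc: "h (Suc i) = h i + e (d - i)" for i
    by (simp add: h_def)
  show thesis
  proof
    show "h 0 = 0" by (simp add: h_def)
    show "0 \<le> h i" for i unfolding h_def by (intro sum_nonneg e_nonneg)
    fix i assume i: "i \<in> {1..d}"
    then have "c i * e (Suc (d - i)) = c i + a i + b i + b i * e (d - i)"
      using e[of "d - i"] c[OF i] by simp
    moreover have "h i = h (i - 1) + e (Suc (d - i))"
      using h_Suc[of "i - 1"] i by (simp add: Suc_diff_le)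
    moreover have "h (i + 1) = h i + e (d - i)"
      using h_Suc[of i] by simp
    ultimately show "(c i + a i + b i) * h i
        = (c i + a i + b i) + (c i * h (i - 1) + a i * h i + b i * h (i + 1))"
      by (simp add: algebra_simps)
  qed
qed

section \<open>From the quotient matrix to the walks\<close>

text \<open>
  For the last column the term \<open>b_arr G v j\<close> has no row in the matrix; it can be kept in the formula
  because it vanishes, so that all columns obey the same recurrence.
\<close>

lemma sum_B_mat_column:
  fixes f :: "nat \<Rightarrow> real"
  assumes "1 \<le> j" "j \<le> eccentricity G v" "j = eccentricity G v \<Longrightarrow> b_arr G v j = 0"
  shows "(\<Sum>r\<in>idx (B_mat G v). f r * ent (B_mat G v) r j)
    = c_arr G v j * f (j - 1) + a_arr G v j * f j + b_arr G v j * f (j + 1)"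
proof -
  let ?d = "eccentricity G v"
  have "f r * ent (B_mat G v) r j = (if r = j - 1 then c_arr G v j * f r else 0)
      + (if r = j then a_arr G v j * f r else 0) + (if r = j + 1 then b_arr G v j * f r else 0)" for r
    using assms(1) by (auto simp: B_mat_def)
  moreover have "idx (B_mat G v) = {0..?d}" by (simp add: B_mat_def)
  moreover have "j - 1 \<le> ?d" using assms(2) by simp
  moreover have "b_arr G v j = 0" if "\<not> Suc j \<le> ?d"
    using assms(2,3) that by simp
  ultimately show ?thesis
    using assms(2) by (simp add: sum.distrib)
qed

text \<open>
  The form in which both chains are treated: clearing the denominators of \<open>T_mat M\<close>, and
  extending \<open>h\<close> by \<open>0\<close> at the deleted index, turns the condition of \<^locale>\<open>hitting_vector\<close> into an
  identity between full column sums of \<open>M\<close>.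
\<close>

lemma hitting_vector_del_T_mat:
  assumes fin: "finite (idx M)" and v: "v \<in> idx M"
    and nonneg: "\<And>x y. x \<in> idx M \<Longrightarrow> y \<in> idx M \<Longrightarrow> 0 \<le> ent M x y"
    and h: "\<And>x. x \<in> idx M \<Longrightarrow> 0 \<le> h x" "h v = 0"
    and pos: "\<And>y. y \<in> idx M \<Longrightarrow> y \<noteq> v \<Longrightarrow> 0 < (\<Sum>x\<in>idx M. ent M x y)"
    and eq: "\<And>y. y \<in> idx M \<Longrightarrow> y \<noteq> v \<Longrightarrow>
      (\<Sum>x\<in>idx M. ent M x y) * h y = (\<Sum>x\<in>idx M. ent M x y) + (\<Sum>x\<in>idx M. h x * ent M x y)"
  shows "hitting_vector (del_mat (T_mat M) v) h"
proof
  show "finite (idx (del_mat (T_mat M) v))" using fin by (simp add: del_mat_def T_mat_def)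
  fix y assume "y \<in> idx (del_mat (T_mat M) v)"
  then have y: "y \<in> idx M" "y \<noteq> v" by (auto simp: del_mat_def T_mat_def)
  show "0 \<le> h y" using h(1) y by blast
  have "row_times (del_mat (T_mat M) v) h y
      = (\<Sum>x\<in>idx M. h x * ent M x y) / (\<Sum>x\<in>idx M. ent M x y)"
    using fin v h(2) by (simp add: row_times_def del_mat_def T_mat_def sum_divide_distrib sum_diff1)
  then have "(\<Sum>x\<in>idx M. ent M x y) * h y
      = (\<Sum>x\<in>idx M. ent M x y) * (1 + row_times (del_mat (T_mat M) v) h y)"
    using eq[OF y] pos[OF y] by (simp add: distrib_left)
  then show "h y = 1 + row_times (del_mat (T_mat M) v) h y"
    using pos[OF y] by simp
next
  fix x y assume "x \<in> idx (del_mat (T_mat M) v)" "y \<in> idx (del_mat (T_mat M) v)"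
  then show "0 \<le> ent (del_mat (T_mat M) v) x y"
    using nonneg by (auto simp: del_mat_def T_mat_def intro!: divide_nonneg_nonneg sum_nonneg)
qed

lemma expected_hitting_time_step_cong:
  assumes "step_pmf M = step_pmf M'"
  shows "expected_hitting_time M = expected_hitting_time M'"
proof -
  have "chain_step M = chain_step M'"
    unfolding chain_step_def[abs_def] assms ..
  then show ?thesis
    unfolding expected_hitting_time_def chain_measure_def by simp
qed

context connected_pair_graph
begin

lemma adj_mat_simps: "idx (adj_mat G) = pverts G" "ent (adj_mat G) x y = (if (x, y) \<in> parcs G then 1 else 0)"
  by (simp_all add: adj_mat_def)

lemma sum_adj_mat_column:
  "(\<Sum>x\<in>pverts G. f x * ent (adj_mat G) x w) = (\<Sum>x\<in>neighbours G w. f x)"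
proof -
  have "ent (adj_mat G) x w = (if (w, x) \<in> parcs G then 1 else 0)" for x
    using parcs_sym by (auto simp: adj_mat_simps)
  then show ?thesis
    by (simp only: mult.commute[of "f _"] sum_over_neighbours)
qed

text \<open>
  The weights \<open>\<nu>\<close> of the neighbours of \<open>w\<close> cancel in the normalised column of \<open>w\<close>, so the two walks
  have the same transition probabilities.
\<close>

lemma H_merw_eq_H_srw:
  assumes pos: "\<And>w. w \<in> pverts G \<Longrightarrow> 0 < \<nu> w"
    and const: "\<And>w x y. x \<in> neighbours G w \<Longrightarrow> y \<in> neighbours G w \<Longrightarrow> \<nu> x = \<nu> y"
  shows "H_merw G \<nu> = H_srw G"
  unfolding H_merw_def H_srw_def
proof (intro expected_hitting_time_step_cong ext)
  fix w
  let ?N = "times_mat (diag_mat (pverts G) \<nu>) (adj_mat G)"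
  let ?S = "T_mat (adj_mat G)" and ?M = "T_mat ?N"
  have idx: "idx ?N = pverts G" by (simp add: times_mat_def diag_mat_def)
  have prod: "ent ?N x w = \<nu> x * ent (adj_mat G) x w"
    if "x \<in> pverts G" for x
    using that pair_finite_verts by (simp add: times_mat_def diag_mat_def mult_delta_left)
  have "ent ?M x w = ent ?S x w" if x: "x \<in> pverts G" for x
  proof (cases "x \<in> neighbours G w")
    case True
    have "(\<Sum>y\<in>idx ?N. ent ?N y w) = (\<Sum>y\<in>neighbours G w. \<nu> y)"
      by (simp only: idx prod sum_adj_mat_column cong: sum.cong)
    also have "\<dots> = \<nu> x * card (neighbours G w)"
      using const[OF _ True] by simp
    also have "real (card (neighbours G w)) = (\<Sum>y\<in>pverts G. ent (adj_mat G) y w)"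
      using sum_adj_mat_column[of "\<lambda>_. 1" w] by simp
    finally show ?thesis
      using pos[OF x] by (simp add: T_mat_def prod x adj_mat_simps(1))
  next
    case False
    then have "ent (adj_mat G) x w = 0"
      using parcs_sym by (auto simp: adj_mat_simps neighbours_def)
    then show ?thesis by (simp add: T_mat_def prod x)
  qed
  then show "step_pmf ?M w = step_pmf ?S w"
    unfolding step_pmf_def
    by (intro arg_cong[of _ _ embed_pmf]) (auto simp: T_mat_def idx adj_mat_simps(1))
qed

end

theorem theorem4p2:
  fixes G :: "'a pair_pre_digraph" and v u :: 'a and \<nu> :: "'a \<Rightarrow> real" and i :: nat
  assumes "distance_regularized_graph G"
    and "perron_eigenvector (adj_mat G) \<nu>"
    and "v \<in> pverts G"
    and "i \<in> {1..eccentricity G v}"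
    and "u \<in> sphere_at G i v"
  shows "invertible_sqmat (minus_mat (del_mat (T_mat (B_mat G v)) 0) (id_mat {1..eccentricity G v}))
    \<and> H_srw G (v, u) = H_merw G \<nu> (v, u)
    \<and> H_merw G \<nu> (v, u) = ennreal (H_vec (del_mat (T_mat (B_mat G v)) 0) i)"
proof -
  interpret connected_pair_graph G
    using assms(1) by (auto simp: distance_regularized_graph_def connected_pair_graph_def
        connected_pair_graph_axioms_def)
  let ?d = "eccentricity G v" and ?A = "adj_mat G" and ?B = "B_mat G v"
  let ?c = "c_arr G v" and ?a = "a_arr G v" and ?b = "b_arr G v"
  note v = \<open>v \<in> pverts G\<close>
  have reg: "distance_regularized_vertex G w" if "w \<in> pverts G" for w
    using assms(1) that by (simp add: distance_regularized_graph_def)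
  have u: "u \<in> pverts G" "graph_dist G v u = i" "u \<noteq> v"
    using assms(4,5) graph_dist_eq_0[OF v v] by (auto simp: sphere_at_def)
  have arr: "?c j = c_num G v w" "?a j = a_num G v w" "?b j = b_num G v w"
    if "w \<in> pverts G" "w \<noteq> v" "graph_dist G v w = j" for w j
    using intersection_array_eq[OF reg[OF v], of w j] that graph_dist_eq_0[OF v, of w]
    by (simp_all add: sphere_at_def)
  have repr: "\<exists>w. w \<in> pverts G \<and> w \<noteq> v \<and> graph_dist G v w = j" if "j \<in> {1..?d}" for j
    using sphere_nonempty[OF v, of j] graph_dist_eq_0[OF v v] that by (auto simp: sphere_at_def)
  have c_pos: "0 < real (?c j)" if "j \<in> {1..?d}" for j
    using repr[OF that] arr(1) c_num_pos[OF v] by auto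
  have b_end: "?b ?d = 0" if "1 \<le> ?d"
    using repr[of ?d] that arr(3) b_num_eccentricity by auto
  \<comment> \<open>One function of the distance to \<open>v\<close> solves the first-step equations of the quotient chain and,
    composed with the distance, those of the simple random walk.\<close>
  obtain h :: "nat \<Rightarrow> real" where h: "h 0 = 0" "\<And>j. 0 \<le> h j"
      "\<And>j. j \<in> {1..?d} \<Longrightarrow> (?c j + ?a j + ?b j) * h j
        = (?c j + ?a j + ?b j) + (?c j * h (j - 1) + ?a j * h j + ?b j * h (j + 1))"
    using ex_birth_death_hitting[of ?d ?c ?a ?b] c_pos by auto

  have B_column: "(\<Sum>r\<in>idx ?B. f r * ent ?B r j)
      = ?c j * f (j - 1) + ?a j * f j + ?b j * f (j + 1)" if "j \<in> {1..?d}" for f :: "nat \<Rightarrow> real" and j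
    using that b_end by (intro sum_B_mat_column) auto
  have "hitting_vector (del_mat (T_mat ?B) 0) h"
  proof (rule hitting_vector_del_T_mat)
    fix j assume "j \<in> idx ?B" "j \<noteq> 0"
    then have j: "j \<in> {1..?d}" by (simp add: B_mat_def)
    have deg: "(\<Sum>r\<in>idx ?B. ent ?B r j) = ?c j + ?a j + ?b j"
      using B_column[OF j, of "\<lambda>_. 1"] by simp
    show "0 < (\<Sum>r\<in>idx ?B. ent ?B r j)"
      using c_pos[OF j] unfolding deg by simp
    show "(\<Sum>r\<in>idx ?B. ent ?B r j) * h j = (\<Sum>r\<in>idx ?B. ent ?B r j) + (\<Sum>r\<in>idx ?B. h r * ent ?B r j)"
      unfolding deg B_column[OF j] using h(3)[OF j] by simp
  qed (use h in \<open>auto simp: B_mat_def\<close>)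
  then interpret B: hitting_vector "del_mat (T_mat ?B) 0" h .
  have idx_B: "idx (del_mat (T_mat ?B) 0) = {1..?d}"
    by (auto simp: del_mat_def T_mat_def B_mat_def)

  have A_deg: "(\<Sum>x\<in>idx ?A. ent ?A x w) = card (neighbours G w)" for w
    using sum_adj_mat_column[of "\<lambda>_. 1" w] by (simp add: adj_mat_simps(1))
  have A_pos: "0 < (\<Sum>x\<in>idx ?A. ent ?A x w)" if "w \<in> pverts G" for w
    unfolding A_deg using neighbours_nonempty[OF that] u(1,3) v finite_neighbours
    by (metis card_gt_0_iff of_nat_0_less_iff)
  have "hitting_vector (del_mat (T_mat ?A) v) (\<lambda>w. h (graph_dist G v w))"
  proof (rule hitting_vector_del_T_mat)
    show "h (graph_dist G v v) = 0" using graph_dist_eq_0[OF v v] h(1) by simp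
    fix w assume "w \<in> idx ?A" "w \<noteq> v"
    then have w: "w \<in> pverts G" "w \<noteq> v" by (simp_all add: adj_mat_simps)
    show "0 < (\<Sum>x\<in>idx ?A. ent ?A x w)" by (rule A_pos[OF w(1)])
    have j: "graph_dist G v w \<in> {1..?d}"
      using graph_dist_le_eccentricity[OF w(1)] graph_dist_eq_0[OF v w(1)] w(2)
      by (simp add: Suc_le_eq)
    have "(\<Sum>x\<in>idx ?A. h (graph_dist G v x) * ent ?A x w)
        = (\<Sum>x\<in>neighbours G w. h (graph_dist G v x))"
      by (simp only: adj_mat_simps(1) sum_adj_mat_column)
    then show "(\<Sum>x\<in>idx ?A. ent ?A x w) * h (graph_dist G v w)
        = (\<Sum>x\<in>idx ?A. ent ?A x w) + (\<Sum>x\<in>idx ?A. h (graph_dist G v x) * ent ?A x w)"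
      unfolding A_deg sum_neighbours_by_distance[OF v w] card_neighbours_eq[OF v w]
      using h(3)[OF j] arr[OF w refl] by simp
  qed (use h v pair_finite_verts in \<open>auto simp: adj_mat_simps\<close>)
  then have "expected_hitting_time (T_mat ?A) (v, u) = ennreal (h (graph_dist G v u))"
  proof (rule expected_hitting_time_eq[rotated 3])
    fix w assume "w \<in> idx (T_mat ?A)"
    then have "w \<in> pverts G" by (simp add: T_mat_def adj_mat_simps)
    from A_pos[OF this] show "(\<Sum>x\<in>idx (T_mat ?A). ent (T_mat ?A) x w) = 1"
      by (simp add: T_mat_def flip: sum_divide_distrib)
  qed (use u pair_finite_verts in \<open>auto simp: T_mat_def adj_mat_simps intro!: divide_nonneg_nonneg sum_nonneg\<close>)
  then have srw: "H_srw G (v, u) = ennreal (h i)"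
    by (simp add: H_srw_def u(2))

  obtain t where \<nu>: "\<And>w. w \<in> pverts G \<Longrightarrow> 0 < \<nu> w"
      "\<And>w. w \<in> pverts G \<Longrightarrow> (\<Sum>x\<in>pverts G. ent ?A w x * \<nu> x) = t * \<nu> w"
    using assms(2) by (auto simp: perron_eigenvector_def eigenvector_mat_def adj_mat_simps(1))
  have "(\<Sum>x\<in>neighbours G w. \<nu> x) = t * \<nu> w" if "w \<in> pverts G" for w
  proof -
    have "ent ?A w x = ent ?A x w" for x using parcs_sym by (auto simp: adj_mat_simps)
    then show ?thesis
      using \<nu>(2)[OF that] sum_adj_mat_column[of \<nu> w] by (simp add: mult.commute)
  qed
  then have "\<nu> x = \<nu> y" if "x \<in> neighbours G w" "y \<in> neighbours G w" for w x y
    using perron_constant_on_neighbours[of \<nu> t x w y] reg \<nu>(1) that by blast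
  then have "H_merw G \<nu> = H_srw G"
    by (intro H_merw_eq_H_srw \<nu>(1))
  then show ?thesis
    using B.invertible B.H_vec_eq[of i] srw assms(4) by (simp add: idx_B)
qed

end
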